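(* Let $\mathcal{T}_{\mathrm{fb}}$ (the transfer operator of a feedback loop in an operadic network) be a bounded linear operator on a Banach space, let $F$ be a spectrally analytic operadic propagation map, and let $A_*$ be a fixed point satisfying $A_*=F(\mathcal{T}_{\mathrm{fb}}(A_* ))$. Define the linearized one-cycle feedback operator $$\mathcal{M}_{\mathrm{fb}}:=\partial^{\mathrm{spec}}F(A_* )\circ\mathcal{T}_{\mathrm{fb}},$$ where $\partial^{\mathrm{spec}}F(A_* )$ is the first spectral derivative evaluated at the fixed point. (a) (Any bounded linear operators, including non-commuting and non-normal ones.) The feedback loop is linearly spectrally stable if and only if $\rho(\mathcal{M}_{\mathrm{fb}})<1$. (b) If $\partial^{\mathrm{spec}}F(A_* )$ and $\mathcal{T}_{\mathrm{fb}}$ are commuting normal operators, then the condition $$\rho(\mathcal{T}_{\mathrm{fb}})\,\rho(\partial^{\mathrm{spec}}F(A_* ))<1$$ implies feedback stability; equivalently, $\rho(\mathcal{T}_{\mathrm{fb}})<r_{\mathrm{SOC}}(F,A_* )$, where $r_{\mathrm{SOC}}(F,A_* ):=1/\rho(\partial^{\mathrm{spec}}F(A_* ))$. (c) For non-commuting operators the inequality $\rho(AB)\le\rho(A)\rho(B)$ is generally false, so the sufficient condition of (b) does not apply; one must use the criterion of (a) directly or other estimates such as $\|\mathcal{M}_{\mathrm{fb}}\|<1$, which is sufficient but not necessary for stability.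
   Context: $\rho$ denotes spectral radius. $F$ is a map on the Banach spectral state space that is spectrally analytic: it has a locally convergent Taylor expansion $F(A+\delta A)=F(A)+\sum_{k\ge1}\frac1{k!}\partial^{\mathrm{spec}}_kF(A)[\delta A^{\otimes k}]$ with bounded $k$-multilinear coefficients; $\partial^{\mathrm{spec}}F=\partial_1^{\mathrm{spec}}F$ is a bounded linear operator. "Linearly spectrally stable" (feedback stability) means: for the linearized perturbation dynamics $\delta A_{k+1}=\mathcal{M}_{\mathrm{fb}}(\delta A_k)$ one has $\delta A_k\to0$ exponentially for all initial perturbations $\delta A_0$. Conventions: $1/0=\infty$ and $1/\infty=0$ in the definition of the SOC stability radius $r_{\mathrm{SOC}}$. In (b), normality presupposes that the underlying space is a Hilbert space. *)

theory Defs
  imports "HOL-Analysis.Analysis"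
begin

section \<open>Complex Banach and Hilbert spaces\<close>

text \<open>The norm, topology and completeness are those of the underlying real Banach space;
  the complex scalar multiplication extends the real one.\<close>

class complex_banach = banach +
  fixes scaleC :: "complex \<Rightarrow> 'a \<Rightarrow> 'a"  (infixr \<open>*\<^sub>C\<close> 75)
  assumes scaleC_add_right: "a *\<^sub>C (x + y) = a *\<^sub>C x + a *\<^sub>C y"
    and scaleC_add_left: "(a + b) *\<^sub>C x = a *\<^sub>C x + b *\<^sub>C x"
    and scaleC_scaleC: "a *\<^sub>C (b *\<^sub>C x) = (a * b) *\<^sub>C x"
    and scaleC_of_real: "complex_of_real r *\<^sub>C x = r *\<^sub>R x"
    and norm_scaleC: "norm (a *\<^sub>C x) = cmod a * norm x"

class complex_hilbert = complex_banach +
  fixes cinner :: "'a \<Rightarrow> 'a \<Rightarrow> complex"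
  assumes cinner_commute: "cinner x y = cnj (cinner y x)"
    and cinner_add_left: "cinner (x + y) z = cinner x z + cinner y z"
    and cinner_scaleC_left: "cinner (a *\<^sub>C x) y = a * cinner x y"
    and cinner_norm: "cinner x x = complex_of_real ((norm x)\<^sup>2)"

instantiation complex :: complex_banach
begin

definition scaleC_complex :: "complex \<Rightarrow> complex \<Rightarrow> complex" where
  "scaleC_complex a x = a * x"

instance
  by standard (simp_all add: scaleC_complex_def algebra_simps scaleR_conv_of_real norm_mult)

end

instantiation vec :: (complex_banach, finite) complex_banach
begin

definition scaleC_vec :: "complex \<Rightarrow> 'a ^ 'b \<Rightarrow> 'a ^ 'b" where
  "scaleC_vec a x = (\<chi> i. a *\<^sub>C (x $ i))"

instance
proof
  fix a b :: complex and r :: real and x y :: "'a ^ 'b"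
  show "a *\<^sub>C (x + y) = a *\<^sub>C x + a *\<^sub>C y"
    by (simp add: scaleC_vec_def vec_eq_iff scaleC_add_right)
  show "(a + b) *\<^sub>C x = a *\<^sub>C x + b *\<^sub>C x"
    by (simp add: scaleC_vec_def vec_eq_iff scaleC_add_left)
  show "a *\<^sub>C (b *\<^sub>C x) = (a * b) *\<^sub>C x"
    by (simp add: scaleC_vec_def vec_eq_iff scaleC_scaleC)
  show "complex_of_real r *\<^sub>C x = r *\<^sub>R x"
    by (simp add: scaleC_vec_def vec_eq_iff scaleC_of_real)
  show "norm (a *\<^sub>C x) = cmod a * norm x"
    by (simp add: scaleC_vec_def norm_vec_def norm_scaleC L2_set_right_distrib)
qed

end


section \<open>Bounded operators, spectrum, spectral radius\<close>

definition bounded_clinear :: "('a::complex_banach \<Rightarrow> 'b::complex_banach) \<Rightarrow> bool" where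
  "bounded_clinear T \<longleftrightarrow> bounded_linear T \<and> (\<forall>a x. T (a *\<^sub>C x) = a *\<^sub>C T x)"

definition op_spectrum :: "('a::complex_banach \<Rightarrow> 'a) \<Rightarrow> complex set" where
  "op_spectrum T = {z. \<not> (\<exists>R. bounded_clinear R \<and>
      (\<forall>x. R (z *\<^sub>C x - T x) = x) \<and> (\<forall>x. z *\<^sub>C R x - T (R x) = x))}"

text \<open>The value lies in \<open>[0,\<infinity>]\<close>, so that the supremum over the empty spectrum (which occurs
  only on the zero space) is \<open>0\<close>, and division follows \<open>1 / 0 = \<infinity>\<close> and \<open>1 / \<infinity> = 0\<close>.\<close>

definition op_spectral_radius :: "('a::complex_banach \<Rightarrow> 'a) \<Rightarrow> ennreal" where
  "op_spectral_radius T = (SUP z\<in>op_spectrum T. ennreal (cmod z))"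

definition cadjoint :: "('a::complex_hilbert \<Rightarrow> 'a) \<Rightarrow> 'a \<Rightarrow> 'a" where
  "cadjoint T = (SOME S. \<forall>x y. cinner (T x) y = cinner x (S y))"

definition normal_op :: "('a::complex_hilbert \<Rightarrow> 'a) \<Rightarrow> bool" where
  "normal_op T \<longleftrightarrow> bounded_clinear T \<and> T \<circ> cadjoint T = cadjoint T \<circ> T"


section \<open>Spectrally analytic maps\<close>

text \<open>A \<open>k\<close>-linear map is encoded as a function of a sequence of arguments that depends only on
  the entries \<open>0, \<dots>, k - 1\<close>.\<close>

definition bounded_cmultilinear :: "nat \<Rightarrow> ((nat \<Rightarrow> 'a::complex_banach) \<Rightarrow> 'a) \<Rightarrow> bool" where
  "bounded_cmultilinear k m \<longleftrightarrow>
     (\<forall>v w. (\<forall>i<k. v i = w i) \<longrightarrow> m v = m w) \<and>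
     (\<forall>i<k. \<forall>v x y. m (v(i := x + y)) = m (v(i := x)) + m (v(i := y))) \<and>
     (\<forall>i<k. \<forall>v a x. m (v(i := a *\<^sub>C x)) = a *\<^sub>C m (v(i := x))) \<and>
     (\<exists>C. \<forall>v. norm (m v) \<le> C * (\<Prod>i<k. norm (v i)))"

definition has_spec_taylor ::
    "('a::complex_banach \<Rightarrow> 'a) \<Rightarrow> 'a \<Rightarrow> (nat \<Rightarrow> (nat \<Rightarrow> 'a) \<Rightarrow> 'a) \<Rightarrow> bool" where
  "has_spec_taylor F A c \<longleftrightarrow>
     (\<forall>k\<ge>1. bounded_cmultilinear k (c k)) \<and>
     (\<exists>r>0. \<forall>h. norm h < r \<longrightarrow>
        (\<lambda>k. (1 / fact (Suc k)) *\<^sub>R c (Suc k) (\<lambda>_. h)) sums (F (A + h) - F A))"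

definition spectrally_analytic :: "('a::complex_banach \<Rightarrow> 'a) \<Rightarrow> bool" where
  "spectrally_analytic F \<longleftrightarrow> (\<forall>A. \<exists>c. has_spec_taylor F A c)"

text \<open>For \<open>k \<ge> 2\<close> the expansion determines the coefficient only up to symmetrization;
  for \<open>k = 1\<close> it is unique, see \<open>spec_deriv_eqI\<close> below.\<close>

definition spec_deriv_k ::
    "nat \<Rightarrow> ('a::complex_banach \<Rightarrow> 'a) \<Rightarrow> 'a \<Rightarrow> (nat \<Rightarrow> 'a) \<Rightarrow> 'a" where
  "spec_deriv_k k F A = (SOME c. has_spec_taylor F A c) k"

definition spec_deriv :: "('a::complex_banach \<Rightarrow> 'a) \<Rightarrow> 'a \<Rightarrow> 'a \<Rightarrow> 'a" where
  "spec_deriv F A h = spec_deriv_k 1 F A (\<lambda>_. h)"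

lemma bounded_cmultilinear_diag_scaleC:
  assumes "bounded_cmultilinear k m"
  shows "m (\<lambda>_. a *\<^sub>C h) = a ^ k *\<^sub>C m (\<lambda>_. h)"
proof -
  have one: "1 *\<^sub>C x = x" for x :: 'a
    using scaleC_of_real[of 1 x] by simp
  have step: "m (\<lambda>i. if i < j then a *\<^sub>C h else h) = a ^ j *\<^sub>C m (\<lambda>_. h)" if "j \<le> k" for j
    using that
  proof (induction j)
    case 0
    then show ?case by (simp add: one)
  next
    case (Suc j)
    let ?v = "\<lambda>i. if i < j then a *\<^sub>C h else h"
    have "(\<lambda>i. if i < Suc j then a *\<^sub>C h else h) = ?v(j := a *\<^sub>C h)"
      by (auto simp: less_Suc_eq)
    then have "m (\<lambda>i. if i < Suc j then a *\<^sub>C h else h) = a *\<^sub>C m (?v(j := h))"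
      using assms Suc.prems unfolding bounded_cmultilinear_def by simp
    also have "?v(j := h) = ?v"
      by auto
    finally show ?case
      using Suc by (simp add: scaleC_scaleC)
  qed
  have "m (\<lambda>_. a *\<^sub>C h) = m (\<lambda>i. if i < k then a *\<^sub>C h else h)"
    using assms unfolding bounded_cmultilinear_def by auto
  then show ?thesis
    using step[of k] by simp
qed

lemma power_series_first_coeff_zero:
  fixes b :: "nat \<Rightarrow> 'a::banach"
  assumes s: "s > 0" and z: "\<And>t. 0 < t \<Longrightarrow> t \<le> s \<Longrightarrow> (\<lambda>k. t ^ Suc k *\<^sub>R b k) sums 0"
  shows "b 0 = 0"
proof -
  have "Bseq (\<lambda>k. s ^ Suc k *\<^sub>R b k)"
    using summable_LIMSEQ_zero[OF sums_summable[OF z[of s]]] s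
    by (intro convergent_imp_Bseq convergentI) simp
  then obtain K where K: "K > 0" "\<And>k. norm (s ^ Suc k *\<^sub>R b k) \<le> K"
    by (auto simp: Bseq_def)
  have bound: "norm (b 0) \<le> q * (2 * K / s)" if q: "0 < q" "q \<le> 1 / 2" for q
  proof -
    let ?f = "\<lambda>k. (q * s) ^ Suc k *\<^sub>R b k"
    have "q * s \<le> s" using q s by simp
    then have f: "?f sums 0" using z[of "q * s"] q s by simp
    then have g: "(\<lambda>k. ?f (Suc k)) sums (- ?f 0)"
      by (subst sums_Suc_iff) simp
    have le: "norm (?f (Suc k)) \<le> K * q\<^sup>2 * q ^ k" for k
    proof -
      have "norm (?f (Suc k)) = q ^ Suc (Suc k) * norm (s ^ Suc (Suc k) *\<^sub>R b (Suc k))"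
        using q s by (simp add: power_mult_distrib abs_mult mult_ac)
      also have "\<dots> \<le> q ^ Suc (Suc k) * K"
        using K(2)[of "Suc k"] q by (intro mult_left_mono) auto
      finally show ?thesis by (simp add: power2_eq_square mult_ac)
    qed
    have geo: "(\<lambda>k. K * q\<^sup>2 * q ^ k) sums (K * q\<^sup>2 * (1 / (1 - q)))"
      using q by (intro sums_mult geometric_sums) auto
    have "norm (- ?f 0) \<le> K * q\<^sup>2 * (1 / (1 - q))"
      using norm_suminf_le[OF le sums_summable[OF geo]]
      unfolding sums_unique[OF g, symmetric] sums_unique[OF geo, symmetric] .
    also have "\<dots> \<le> K * q\<^sup>2 * 2"
      using q K(1) by (intro mult_left_mono) (auto simp: field_simps)
    finally have "q * s * norm (b 0) \<le> q * s * (q * (2 * K / s))"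
      using q s by (simp add: power2_eq_square mult_ac)
    then show ?thesis using q s by (subst (asm) mult_le_cancel_left_pos) auto
  qed
  have "((\<lambda>q. q * (2 * K / s)) \<longlongrightarrow> 0 * (2 * K / s)) (at_right 0)"
    by (intro tendsto_intros)
  moreover have "\<forall>\<^sub>F q in at_right (0::real). norm (b 0) \<le> q * (2 * K / s)"
    by (rule eventually_mono[OF eventually_at_right_real[of 0 "1/2"]]) (simp, rule bound, auto)
  ultimately have "norm (b 0) \<le> 0 * (2 * K / s)"
    by (intro tendsto_lowerbound[OF _ _ trivial_limit_at_right_real])
  then show ?thesis by simp
qed

lemma has_spec_taylor_unique_1:
  assumes c: "has_spec_taylor F A c" and d: "has_spec_taylor F A d"
  shows "c 1 (\<lambda>_. h) = d 1 (\<lambda>_. h)"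
proof -
  obtain r where r: "r > 0" "\<And>h. norm h < r \<Longrightarrow>
      (\<lambda>k. (1 / fact (Suc k)) *\<^sub>R c (Suc k) (\<lambda>_. h)) sums (F (A + h) - F A)"
    using c unfolding has_spec_taylor_def by blast
  obtain r' where r': "r' > 0" "\<And>h. norm h < r' \<Longrightarrow>
      (\<lambda>k. (1 / fact (Suc k)) *\<^sub>R d (Suc k) (\<lambda>_. h)) sums (F (A + h) - F A)"
    using d unfolding has_spec_taylor_def by blast
  define s where "s = min r r' / (2 * (norm h + 1))"
  have n: "norm h + 1 > 0" by (simp add: add_nonneg_pos)
  have s: "s > 0" using r r' n by (simp add: s_def)
  have hom: "e (Suc k) (\<lambda>_. t *\<^sub>R h) = t ^ Suc k *\<^sub>R e (Suc k) (\<lambda>_. h)"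
    if "has_spec_taylor F A e" for e t k
    using bounded_cmultilinear_diag_scaleC[of "Suc k" "e (Suc k)" "complex_of_real t" h] that
    unfolding has_spec_taylor_def scaleC_of_real of_real_power[symmetric] by simp
  let ?b = "\<lambda>k. (1 / fact (Suc k)) *\<^sub>R (c (Suc k) (\<lambda>_. h) - d (Suc k) (\<lambda>_. h))"
  have "(\<lambda>k. t ^ Suc k *\<^sub>R ?b k) sums 0" if t: "0 < t" "t \<le> s" for t
  proof -
    have "norm (t *\<^sub>R h) \<le> s * (norm h + 1)"
      using t by (auto intro!: mult_mono)
    also have "\<dots> = min r r' / 2"
      unfolding s_def using n by (simp del: distrib_left_numeral)
    also have "\<dots> < min r r'"
      using r(1) r'(1) by linarith
    finally have "norm (t *\<^sub>R h) < r" "norm (t *\<^sub>R h) < r'" by auto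
    from sums_diff[OF r(2)[OF this(1)] r'(2)[OF this(2)]]
    show ?thesis
      by (simp add: hom[OF c] hom[OF d] algebra_simps scaleR_diff_right del: fact_Suc power_Suc)
  qed
  from power_series_first_coeff_zero[OF s this] show ?thesis by simp
qed

lemma spec_deriv_eqI:
  assumes "has_spec_taylor F A c"
  shows "spec_deriv F A h = c 1 (\<lambda>_. h)"
  unfolding spec_deriv_def spec_deriv_k_def
  using has_spec_taylor_unique_1[OF someI[of "has_spec_taylor F A", OF assms] assms] .


section \<open>Feedback loops\<close>

definition feedback_loop :: "('a::complex_banach \<Rightarrow> 'a) \<Rightarrow> ('a \<Rightarrow> 'a) \<Rightarrow> 'a \<Rightarrow> bool" where
  "feedback_loop T F A \<longleftrightarrow> bounded_clinear T \<and> spectrally_analytic F \<and> A = F (T A)"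

definition feedback_op :: "('a::complex_banach \<Rightarrow> 'a) \<Rightarrow> ('a \<Rightarrow> 'a) \<Rightarrow> 'a \<Rightarrow> 'a \<Rightarrow> 'a" where
  "feedback_op T F A = spec_deriv F A \<circ> T"

definition lin_spec_stable :: "('a::complex_banach \<Rightarrow> 'a) \<Rightarrow> ('a \<Rightarrow> 'a) \<Rightarrow> 'a \<Rightarrow> bool" where
  "lin_spec_stable T F A \<longleftrightarrow>
     (\<forall>\<delta>. (\<forall>k. \<delta> (Suc k) = feedback_op T F A (\<delta> k)) \<longrightarrow>
        (\<exists>C q. 0 < q \<and> q < 1 \<and> (\<forall>k. norm (\<delta> k) \<le> C * q ^ k)))"

definition soc_radius :: "('a::complex_banach \<Rightarrow> 'a) \<Rightarrow> 'a \<Rightarrow> ennreal" where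
  "soc_radius F A = 1 / op_spectral_radius (spec_deriv F A)"

end

theory Submission
  imports Defs
begin

text \<open>The core is that \<open>\<rho>(M) < q\<close> forces \<open>\<parallel>M\<^sup>n\<parallel> \<le> C q\<^sup>n\<close>. Contour integrals are avoided by
  Rickart's argument: averaging the resolvent \<open>(1 - z M)\<^sup>-\<^sup>1\<close> over the points \<open>z = \<omega> s\<close>,
  \<open>\<omega>\<^sup>n = 1\<close>, gives \<open>(1 - s\<^sup>n M\<^sup>n)\<^sup>-\<^sup>1\<close>. The resolvent is uniformly Lipschitz on the disc
  \<open>cmod z \<le> 1 / q\<close>, so boundedness of \<open>s\<^sup>n M\<^sup>n\<close> in \<open>n\<close> propagates from radius \<open>s\<close> to \<open>s + d\<close> with
  \<open>d\<close> independent of \<open>s\<close> and \<open>n\<close>, hence from \<open>0\<close> to \<open>1 / q\<close>. Conversely the Baire category theorem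
  makes the decay rate uniform over all orbits, and a Neumann series then inverts \<open>z - M\<close> outside a
  disc of radius less than \<open>1\<close>. For commuting operators the power bounds multiply; the
  counterexamples are \<open>2 \<times> 2\<close> matrix units.\<close>

section \<open>Bounded complex-linear operators\<close>

interpretation scaleC: vector_space "scaleC :: complex \<Rightarrow> 'a::complex_banach \<Rightarrow> 'a"
proof
  show "1 *\<^sub>C x = x" for x :: 'a
    using scaleC_of_real[of 1 x] by simp
qed (simp_all add: scaleC_add_right scaleC_add_left scaleC_scaleC)

lemma bounded_clinear_linear: "bounded_clinear T \<Longrightarrow> linear T"
  by (simp add: bounded_clinear_def bounded_linear.linear)

lemma bounded_clinear_scaleC: "bounded_clinear T \<Longrightarrow> T (a *\<^sub>C x) = a *\<^sub>C T x"
  by (simp add: bounded_clinear_def)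

lemma bounded_clinear_id: "bounded_clinear (\<lambda>x. x)"
  by (simp add: bounded_clinear_def)

lemma bounded_clinear_comp:
  "bounded_clinear S \<Longrightarrow> bounded_clinear T \<Longrightarrow> bounded_clinear (S \<circ> T)"
  by (simp add: bounded_clinear_def bounded_linear_compose o_def)

lemma bounded_clinear_funpow:
  fixes T :: "'a::complex_banach \<Rightarrow> 'a"
  shows "bounded_clinear T \<Longrightarrow> bounded_clinear (T ^^ n)"
  by (induction n) (simp_all add: bounded_clinear_comp bounded_clinear_id id_def)

lemma bounded_clinear_scaleC_left: "bounded_clinear (\<lambda>x. a *\<^sub>C x)"
  unfolding bounded_clinear_def
  by (auto intro!: bounded_linear_intro[where K = "cmod a"]
      simp: scaleC_add_right norm_scaleC scaleC_scaleC mult.commute simp flip: scaleC_of_real)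

lemma bounded_clinear_norm_le: "bounded_clinear T \<Longrightarrow> norm (T x) \<le> onorm T * norm x"
  by (simp add: bounded_clinear_def onorm)

lemma bounded_clinear_norm_funpow_le:
  fixes T :: "'a::complex_banach \<Rightarrow> 'a"
  assumes "bounded_clinear T"
  shows "norm ((T ^^ n) x) \<le> onorm T ^ n * norm x"
proof (induction n)
  case (Suc n)
  have "norm (T ((T ^^ n) x)) \<le> onorm T * norm ((T ^^ n) x)"
    by (rule bounded_clinear_norm_le[OF assms])
  also have "\<dots> \<le> onorm T * (onorm T ^ n * norm x)"
    using assms by (intro mult_left_mono Suc onorm_pos_le) (simp add: bounded_clinear_def)
  finally show ?case by (simp add: mult_ac)
qed simp

text \<open>The summands form a geometric progression in k with ratio \<open>?e j\<close>. Its n-th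
  power is 1, while \<open>?e j\<close> itself differs from 1 because n does not divide j.\<close>

lemma sum_roots_of_unity_power:
  fixes n j :: nat
  assumes "0 < j" "j < n"
  shows "(\<Sum>k<n. exp (2 * of_real pi * \<i> * of_nat k / of_nat n) ^ j) = 0"
proof -
  let ?e = "\<lambda>k::nat. exp (2 * of_real pi * \<i> * of_nat k / of_nat n)"
  have "?e k ^ j = ?e j ^ k" for k
    by (simp add: exp_of_nat_mult[symmetric] mult_ac)
  moreover have "?e j \<noteq> 1"
    using complex_root_unity_eq_1[of n j] assms by (auto dest: dvd_imp_le)
  moreover have "?e j ^ n = 1"
    using assms by (simp add: exp_of_nat_mult[symmetric] exp_two_pi_i mult_ac exp_integer_2pi)
  ultimately show ?thesis
    by (simp add: geometric_sum)
qed

section \<open>The resolvent on a closed disc and its averages over roots of unity\<close>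

text \<open>Here \<open>f z\<close> is the inverse of 1 - z M. In this form the resolvent also
  exists at z = 0, and the disc of radius \<open>S > 0\<close> corresponds to the spectral
  parameters 1 / z of modulus at least 1 / S.\<close>

context
  fixes M :: "'a::complex_banach \<Rightarrow> 'a" and f :: "complex \<Rightarrow> 'a \<Rightarrow> 'a" and S :: real
  assumes M: "bounded_clinear M"
    and f: "\<And>z. cmod z \<le> S \<Longrightarrow> bounded_clinear (f z)"
    and left: "\<And>z x. cmod z \<le> S \<Longrightarrow> f z (x - z *\<^sub>C M x) = x"
    and right: "\<And>z x. cmod z \<le> S \<Longrightarrow> f z x - z *\<^sub>C M (f z x) = x"
begin

text \<open>Since \<open>f w y\<close> solves the equation at w, inserting it into the equation at z
  leaves the defect (z - w) M (f w y). Applying \<open>f z\<close> to that defect gives the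
  identity.\<close>

lemma resolvent_identity:
  assumes "cmod z \<le> S" "cmod w \<le> S"
  shows "f z y - f w y = (z - w) *\<^sub>C f z (M (f w y))"
proof -
  have "y - (f w y - z *\<^sub>C M (f w y)) = (z - w) *\<^sub>C M (f w y)"
    using right[OF assms(2), of y] by (simp add: scaleC.scale_left_diff_distrib algebra_simps)
  then have "f z (y - (f w y - z *\<^sub>C M (f w y))) = (z - w) *\<^sub>C f z (M (f w y))"
    using bounded_clinear_scaleC[OF f[OF assms(1)]] by simp
  then show ?thesis
    using left[OF assms(1), of "f w y"] linear_diff[OF bounded_clinear_linear[OF f[OF assms(1)]]]
    by simp
qed

text \<open>Each \<open>f z\<close> is bounded, but nothing is assumed about its dependence on z.
  The resolvent identity gives a locally uniform bound around every centre w, and compactness of the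
  disc leaves finitely many centres.\<close>

lemma resolvent_bounded_on_disc:
  "\<exists>K>0. \<forall>z x. cmod z \<le> S \<longrightarrow> norm (f z x) \<le> K * norm x"
proof -
  \<comment> \<open>The added 1, here and in \<open>L\<close>, makes the radii 1 / (2 L w m)
    positive even if an operator is zero.\<close>
  define m where "m = onorm M + 1"
  have m: "m > 0"
    using M onorm_pos_le[of M] by (auto simp: m_def bounded_clinear_def add_nonneg_pos)
  have Mm: "norm (M x) \<le> m * norm x" for x
    using bounded_clinear_norm_le[OF M, of x] by (simp add: m_def distrib_right add_increasing2)
  define L where "L w = onorm (f w) + 1" for w
  have L: "L w > 0" if "cmod w \<le> S" for w
    using f[OF that] onorm_pos_le[of "f w"] by (auto simp: L_def bounded_clinear_def add_nonneg_pos)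
  have fL: "norm (f w x) \<le> L w * norm x" if "cmod w \<le> S" for w x
    using bounded_clinear_norm_le[OF f[OF that], of x] by (simp add: L_def distrib_right add_increasing2)
  have loc: "norm (f z x) \<le> 2 * L w * norm x"
    if w: "cmod w \<le> S" and z: "cmod z \<le> S" and d: "dist w z < 1 / (2 * L w * m)" for w z x
  proof -
    \<comment> \<open>The unknown \<open>f z x\<close> appears on both sides; the radius around w is
      chosen so that its contribution on the right is at most half its norm and can be
      absorbed.\<close>
    have "f z x = f w x - (w - z) *\<^sub>C f w (M (f z x))"
      using resolvent_identity[OF w z, of x] by (simp add: algebra_simps)
    then have "norm (f z x) \<le> norm (f w x) + cmod (w - z) * norm (f w (M (f z x)))"
      by (metis norm_triangle_ineq4 norm_scaleC)
    also have "\<dots> \<le> L w * norm x + 1 / (2 * L w * m) * (L w * (m * norm (f z x)))"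
      using d L[OF w] m
      by (intro add_mono mult_mono fL[OF w] order_trans[OF fL[OF w] mult_left_mono[OF Mm]])
        (auto simp: dist_norm)
    also have "\<dots> = L w * norm x + norm (f z x) / 2"
      using L[OF w] m by simp
    finally show ?thesis by simp
  qed
  obtain W where W: "W \<subseteq> cball 0 S" "finite W"
      "cball 0 S \<subseteq> (\<Union>w\<in>W. ball w (1 / (2 * L w * m)))"
  proof (rule compactE_image[of "cball 0 S" "cball 0 S" "\<lambda>w. ball w (1 / (2 * L w * m))"])
    show "cball 0 S \<subseteq> (\<Union>w\<in>cball 0 S. ball w (1 / (2 * L w * m)))"
      using L m by force
  qed auto
  have "norm (f z x) \<le> (1 + (\<Sum>w\<in>W. 2 * L w)) * norm x" if z: "cmod z \<le> S" for z x
  proof -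
    obtain w where w: "w \<in> W" "dist w z < 1 / (2 * L w * m)"
      using W(3) z by (force simp: subset_iff)
    have "2 * L w \<le> (\<Sum>w\<in>W. 2 * L w)"
      using W w L by (intro member_le_sum) (auto simp: subset_iff less_imp_le)
    then have "2 * L w * norm x \<le> (1 + (\<Sum>w\<in>W. 2 * L w)) * norm x"
      by (intro mult_right_mono) auto
    then show ?thesis
      using loc[of w z x] w W z by (force simp: subset_iff)
  qed
  moreover have "0 < 1 + (\<Sum>w\<in>W. 2 * L w)"
    using W L by (intro add_pos_nonneg sum_nonneg) (auto simp: subset_iff less_imp_le)
  ultimately show ?thesis by blast
qed

text \<open>Since \<open>1 - w\<^sup>n M\<^sup>n = (1 - w M) (\<Sum>j<n. w\<^sup>j M\<^sup>j)\<close>, every summand equals \<open>\<Sum>j<n. w\<^sup>j M\<^sup>j x\<close>, and the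
  terms with \<open>j > 0\<close> cancel over the roots of unity.\<close>

lemma resolvent_average:
  assumes n: "0 < n" and s: "0 \<le> s" "s \<le> S"
  shows "(\<Sum>k<n. f (exp (2 * of_real pi * \<i> * of_nat k / of_nat n) * of_real s)
            (x - s ^ n *\<^sub>R (M ^^ n) x)) = real n *\<^sub>R x"
proof -
  let ?e = "\<lambda>k::nat. exp (2 * of_real pi * \<i> * of_nat k / of_nat n)"
  let ?w = "\<lambda>k. ?e k * of_real s"
  define u where "u w = (\<Sum>j<n. w ^ j *\<^sub>C (M ^^ j) x)" for w
  have uM: "u w - w *\<^sub>C M (u w) = x - w ^ n *\<^sub>C (M ^^ n) x" for w
  proof -
    have "u w - w *\<^sub>C M (u w) = (\<Sum>j<n. w ^ j *\<^sub>C (M ^^ j) x - w ^ Suc j *\<^sub>C (M ^^ Suc j) x)"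
      using M by (simp add: u_def linear_sum[OF bounded_clinear_linear] bounded_clinear_scaleC
          scaleC.scale_sum_right sum_subtractf)
    also have "\<dots> = x - w ^ n *\<^sub>C (M ^^ n) x"
      using sum_lessThan_telescope'[of "\<lambda>j. w ^ j *\<^sub>C (M ^^ j) x" n] by simp
    finally show ?thesis .
  qed
  \<comment> \<open>All points \<open>?w k\<close> thus share the n-th power s^n, so the vector to
    which the resolvents are applied does not depend on k.\<close>
  have e: "?e k ^ n = 1" for k
    using n by (simp add: exp_of_nat_mult[symmetric] mult_ac exp_integer_2pi)
  have "f (?w k) (x - s ^ n *\<^sub>R (M ^^ n) x) = u (?w k)" for k
  proof -
    have "cmod (?w k) \<le> S"
      using s by (simp add: norm_mult norm_exp_eq_Re)
    moreover have "?w k ^ n = of_real (s ^ n)"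
      by (simp add: power_mult_distrib e)
    ultimately show ?thesis
      using left[of "?w k" "u (?w k)"] by (simp add: uM scaleC_of_real del: of_real_power)
  qed
  then have "(\<Sum>k<n. f (?w k) (x - s ^ n *\<^sub>R (M ^^ n) x)) =
      (\<Sum>j<n. (\<Sum>k<n. ?w k ^ j) *\<^sub>C (M ^^ j) x)"
    by (subst scaleC.scale_sum_left) (simp add: u_def, rule sum.swap)
  also have "\<dots> = (\<Sum>j<n. if j = 0 then real n *\<^sub>R x else 0)"
  proof (intro sum.cong refl)
    fix j assume "j \<in> {..<n}"
    then show "(\<Sum>k<n. ?w k ^ j) *\<^sub>C (M ^^ j) x = (if j = 0 then real n *\<^sub>R x else 0)"
      using sum_roots_of_unity_power[of j n] scaleC_of_real[of "real n" x]
      by (cases "j = 0") (simp_all add: power_mult_distrib flip: sum_distrib_right)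
  qed
  also have "\<dots> = real n *\<^sub>R x"
    using n by (simp add: sum.delta)
  finally show ?thesis .
qed

text \<open>The average \<open>G r / n\<close> inverts 1 - r^n M^n. At s it is within 1/4 of the
  identity because s^n M^n is small; moving to t costs another 1/4 by the Lipschitz bound, which
  survives averaging with a constant independent of n. Being within 1/2 of the identity at t bounds
  t^n M^n by 1.\<close>

lemma power_bound_step:
  assumes K: "0 < K" "\<And>z x. cmod z \<le> S \<Longrightarrow> norm (f z x) \<le> K * norm x"
    and n: "0 < n" and s: "0 \<le> s" "s \<le> S" and t: "0 \<le> t" "t \<le> S"
    and st: "\<bar>s - t\<bar> * onorm M * K\<^sup>2 \<le> 1 / 4"
    and small: "\<And>x. s ^ n * norm ((M ^^ n) x) \<le> norm x / (4 * K)"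
  shows "t ^ n * norm ((M ^^ n) x) \<le> norm x"
proof -
  let ?e = "\<lambda>k::nat. exp (2 * of_real pi * \<i> * of_nat k / of_nat n)"
  define G where "G r y = (\<Sum>k<n. f (?e k * of_real r) y)" for r y
  have disc: "cmod (?e k * of_real r) \<le> S" if "0 \<le> r" "r \<le> S" for k r
    using that by (simp add: norm_mult norm_exp_eq_Re)
  have G: "G r (x - r ^ n *\<^sub>R (M ^^ n) x) = real n *\<^sub>R x" if "0 \<le> r" "r \<le> S" for r x
    unfolding G_def by (rule resolvent_average[OF n that])
  have G_diff: "norm (G t y - G s y) \<le> real n * (norm y / 4)" for y
  proof -
    have "norm (f (?e k * of_real t) y - f (?e k * of_real s) y) \<le> norm y / 4" for k
    proof -
      let ?a = "?e k * of_real t" and ?b = "?e k * of_real s"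
      have "cmod (?a - ?b) = \<bar>s - t\<bar>"
        unfolding right_diff_distrib[symmetric] norm_mult of_real_diff[symmetric]
        by (simp add: norm_exp_eq_Re abs_minus_commute del: of_real_diff)
      then have "norm (f ?a y - f ?b y) = \<bar>s - t\<bar> * norm (f ?a (M (f ?b y)))"
        by (simp add: resolvent_identity[OF disc[OF t] disc[OF s]] norm_scaleC)
      also have "\<dots> \<le> \<bar>s - t\<bar> * (K * (onorm M * (K * norm y)))"
        using K(1) M onorm_pos_le[of M]
        by (intro mult_left_mono order_trans[OF K(2)[OF disc[OF t]]]
            order_trans[OF bounded_clinear_norm_le[OF M]] K(2)[OF disc[OF s]])
          (auto simp: bounded_clinear_def)
      also have "\<dots> = (\<bar>s - t\<bar> * onorm M * K\<^sup>2) * norm y"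
        by (simp add: power2_eq_square mult_ac)
      also have "\<dots> \<le> 1 / 4 * norm y"
        by (intro mult_right_mono st) auto
      finally show ?thesis by simp
    qed
    then show ?thesis
      unfolding G_def sum_subtractf[symmetric]
      by (rule order_trans[OF sum_norm_bound[where K = "norm y / 4"]]) auto
  qed
  \<comment> \<open>By the averaging identity the deviation from n times the identity is
    \<open>G s ?P\<close>; the factor 1 / (4 K) in \<open>small\<close> cancels the bound K of each
    summand.\<close>
  have G_id: "norm (G s y - real n *\<^sub>R y) \<le> real n * (norm y / 4)" for y
  proof -
    let ?P = "s ^ n *\<^sub>R (M ^^ n) y"
    have "G s (y - ?P) = G s y - G s ?P"
      unfolding G_def sum_subtractf[symmetric]
      by (intro sum.cong refl linear_diff bounded_clinear_linear f disc s)
    then have "G s y - real n *\<^sub>R y = G s ?P"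
      using G[OF s, of y] by simp
    moreover have "norm (f (?e k * of_real s) ?P) \<le> norm y / 4" for k
    proof -
      have "norm (f (?e k * of_real s) ?P) \<le> K * norm ?P"
        by (rule K(2)[OF disc[OF s]])
      also have "\<dots> \<le> K * (norm y / (4 * K))"
        using small[of y] s K(1) by (intro mult_left_mono) auto
      finally show ?thesis using K(1) by simp
    qed
    then have "norm (G s ?P) \<le> real n * (norm y / 4)"
      unfolding G_def by (intro order_trans[OF sum_norm_bound[where K = "norm y / 4"]]) auto
    ultimately show ?thesis by simp
  qed
  let ?Q = "t ^ n *\<^sub>R (M ^^ n) x"
  let ?y = "x - ?Q"
  \<comment> \<open>\<open>G t ?y\<close> is n x, and x - \<open>?y\<close> is
    \<open>?Q\<close>.\<close>
  have "real n * norm ?Q = norm (G t ?y - real n *\<^sub>R ?y)"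
    by (simp add: G[OF t] scaleR_right_diff_distrib abs_mult)
  also have "\<dots> \<le> norm (G t ?y - G s ?y) + norm (G s ?y - real n *\<^sub>R ?y)"
    using dist_triangle[of "G t ?y" "real n *\<^sub>R ?y" "G s ?y"] by (simp only: dist_norm)
  also have "\<dots> \<le> real n * (norm ?y / 4) + real n * (norm ?y / 4)"
    by (intro add_mono G_diff G_id)
  also have "\<dots> = real n * (norm ?y / 2)" by simp
  finally have "norm ?Q \<le> norm ?y / 2"
    using n by simp
  also have "\<dots> \<le> (norm x + norm ?Q) / 2"
    by (simp add: norm_triangle_ineq4 del: norm_scaleR)
  finally show ?thesis using t by simp
qed

text \<open>The radius grows from 0 to \<open>S\<close> in steps of fixed length d. Each step first
  retreats from s to s - d, where the bound at s turns into geometric decay and so yields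
  \<open>small\<close> for large n, and then jumps forward to s + d. The finitely many other n are
  bounded by powers of the operator norm.\<close>

lemma power_bounded_on_disc:
  assumes S: "0 \<le> S"
  shows "\<exists>C. \<forall>n x. S ^ n * norm ((M ^^ n) x) \<le> C * norm x"
proof -
  obtain K where K: "0 < K" "\<And>z x. cmod z \<le> S \<Longrightarrow> norm (f z x) \<le> K * norm x"
    using resolvent_bounded_on_disc by blast
  have m: "0 \<le> onorm M"
    using M by (simp add: bounded_clinear_def onorm_pos_le)
  \<comment> \<open>A jump of length 2 d has to meet the condition \<open>st\<close> of
    \<open>power_bound_step\<close>; the added 1 keeps d positive when
    \<open>onorm M = 0\<close>.\<close>
  define d where "d = 1 / (8 * (onorm M + 1) * K\<^sup>2)"
  have d: "0 < d" using m K by (simp add: d_def)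
  have d2: "2 * d * onorm M * K\<^sup>2 \<le> 1 / 4"
  proof -
    have "2 * d * onorm M * K\<^sup>2 = onorm M / (4 * (onorm M + 1))"
      using m K by (simp add: d_def divide_simps)
    also have "\<dots> \<le> 1 / 4"
      using m by (simp add: divide_simps)
    finally show ?thesis .
  qed
  let ?P = "\<lambda>s. \<exists>C. \<forall>n x. s ^ n * norm ((M ^^ n) x) \<le> C * norm x"
  have step: "?P (min S (s + d))" if s: "0 \<le> s" "s \<le> S" and P: "?P s" for s
  proof -
    define s' where "s' = max 0 (s - d)"
    define t where "t = min S (s + d)"
    have s': "0 \<le> s'" "s' \<le> S" using s d by (auto simp: s'_def)
    have t: "0 \<le> t" "t \<le> S" using s d S by (auto simp: t_def)
    have "\<bar>s' - t\<bar> \<le> 2 * d"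
      using s d by (auto simp: s'_def t_def)
    then have "\<bar>s' - t\<bar> * onorm M * K\<^sup>2 \<le> 2 * d * onorm M * K\<^sup>2"
      using m by (intro mult_right_mono) auto
    then have st: "\<bar>s' - t\<bar> * onorm M * K\<^sup>2 \<le> 1 / 4"
      using d2 by simp
    obtain C where C: "\<And>n x. s ^ n * norm ((M ^^ n) x) \<le> C * norm x"
      using P by blast
    \<comment> \<open>For s = 0 also \<open>s' = 0\<close>, so the ratio 0 is consistent.\<close>
    define q where "q = (if s = 0 then 0 else s' / s)"
    have q: "0 \<le> q" "q < 1" "s' = q * s"
      using s d s' by (auto simp: q_def s'_def)
    have "(\<lambda>n. \<bar>C\<bar> * q ^ n) \<longlonglongrightarrow> \<bar>C\<bar> * 0"
      using q by (intro tendsto_mult tendsto_const LIMSEQ_power_zero) auto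
    then have "\<forall>\<^sub>F n in sequentially. \<bar>C\<bar> * q ^ n < 1 / (4 * K)"
      using K by (intro order_tendstoD) auto
    then obtain N where N: "\<And>n. n \<ge> N \<Longrightarrow> \<bar>C\<bar> * q ^ n < 1 / (4 * K)"
      unfolding eventually_sequentially by blast
    have small: "s' ^ n * norm ((M ^^ n) x) \<le> norm x / (4 * K)" if "n \<ge> N" for n x
    proof -
      have "s' ^ n * norm ((M ^^ n) x) = q ^ n * (s ^ n * norm ((M ^^ n) x))"
        by (simp add: q power_mult_distrib mult_ac)
      also have "\<dots> \<le> q ^ n * (\<bar>C\<bar> * norm x)"
        using q by (intro mult_left_mono order_trans[OF C] mult_right_mono) auto
      also have "\<dots> = \<bar>C\<bar> * q ^ n * norm x" by simp
      also have "\<dots> \<le> 1 / (4 * K) * norm x"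
        using N[OF that] by (intro mult_right_mono) auto
      finally show ?thesis by simp
    qed
    \<comment> \<open>The sum serves n up to N and the 1 serves n beyond N. Splitting at
      \<open>n \<le> N\<close> makes n positive in the second case, as averaging over n-th roots of
      unity requires.\<close>
    let ?B = "1 + (\<Sum>n\<le>N. (t * onorm M) ^ n)"
    have nonneg: "0 \<le> (t * onorm M) ^ n" for n
      using t m by simp
    have "t ^ n * norm ((M ^^ n) x) \<le> ?B * norm x" for n x
    proof (cases "n \<le> N")
      case True
      have "t ^ n * norm ((M ^^ n) x) \<le> t ^ n * (onorm M ^ n * norm x)"
        using t by (intro mult_left_mono bounded_clinear_norm_funpow_le M) auto
      also have "\<dots> = (t * onorm M) ^ n * norm x"
        by (simp add: power_mult_distrib)
      also have "\<dots> \<le> ?B * norm x"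
        using True nonneg
        by (intro mult_right_mono add_increasing member_le_sum[of n "{..N}" "\<lambda>n. (t * onorm M) ^ n"]) auto
      finally show ?thesis .
    next
      case False
      then have "t ^ n * norm ((M ^^ n) x) \<le> 1 * norm x"
        using power_bound_step[OF K _ s' t st small, of n x] by simp
      also have "\<dots> \<le> ?B * norm x"
        using nonneg by (intro mult_right_mono) (auto intro: sum_nonneg)
      finally show ?thesis .
    qed
    then show ?thesis unfolding t_def by blast
  qed
  have "?P (min S (real j * d))" for j
  proof (induction j)
    case 0
    have "0 ^ n * norm ((M ^^ n) x) \<le> 1 * norm x" for n x
      by (cases n) auto
    then show ?case using S by (auto simp: min_def intro!: exI[of _ 1])
  next
    case (Suc j)
    have "min S (min S (real j * d) + d) = min S (real (Suc j) * d)"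
      using d by (auto simp: min_def algebra_simps)
    then show ?case
      using step[OF _ _ Suc] S d by simp
  qed
  moreover obtain j where "S \<le> real j * d"
    using reals_Archimedean3[OF d] less_imp_le by blast
  ultimately show ?thesis
    by (metis min.absorb1)
qed

end

section \<open>Power bounds and the spectral radius\<close>

text \<open>For 0 < |z| \<le> 1/q the point 1/z has modulus at least q and so lies outside the
  spectrum. Hence 1 - z M is invertible on the whole disc of radius 1/q, and power boundedness on
  that disc is the claim.\<close>

theorem spectral_radius_less_imp_power_bound:
  fixes M :: "'a::complex_banach \<Rightarrow> 'a"
  assumes M: "bounded_clinear M" and q: "op_spectral_radius M < ennreal q"
  shows "\<exists>C. \<forall>n x. norm ((M ^^ n) x) \<le> C * q ^ n * norm x"
proof -
  \<comment> \<open>\<open>ennreal\<close> sends nonpositive reals to 0, and nothing is below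
    0.\<close>
  have q0: "0 < q"
  proof (rule ccontr)
    assume "\<not> 0 < q"
    with q show False by (simp add: ennreal_neg)
  qed
  have "\<exists>R. bounded_clinear R \<and> (\<forall>x. R (x - z *\<^sub>C M x) = x) \<and> (\<forall>x. R x - z *\<^sub>C M (R x) = x)"
    if z: "cmod z \<le> 1 / q" for z
  proof (cases "z = 0")
    case True
    then show ?thesis
      by (intro exI[of _ "\<lambda>x. x"]) (simp add: bounded_clinear_id)
  next
    case False
    have "1 / z \<notin> op_spectrum M"
    proof
      assume "1 / z \<in> op_spectrum M"
      then have "ennreal (cmod (1 / z)) \<le> op_spectral_radius M"
        unfolding op_spectral_radius_def by (rule SUP_upper)
      with q have "ennreal (cmod (1 / z)) < ennreal q"
        by simp
      then have "cmod (1 / z) < q"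
        using q0 by (simp add: ennreal_less_iff)
      then show False
        using z q0 False by (simp add: norm_divide field_simps)
    qed
    then obtain R where R: "bounded_clinear R" "\<And>x. R ((1 / z) *\<^sub>C x - M x) = x"
        "\<And>x. (1 / z) *\<^sub>C R x - M (R x) = x"
      unfolding op_spectrum_def by blast
    \<comment> \<open>As 1 - z M is z times (1/z - M), its inverse is \<open>R\<close> precomposed
      with multiplication by 1/z.\<close>
    have "R ((1 / z) *\<^sub>C (x - z *\<^sub>C M x)) = x" for x
      using R(2)[of x] False by (simp add: scaleC.scale_right_diff_distrib scaleC_scaleC)
    moreover have "R ((1 / z) *\<^sub>C x) - z *\<^sub>C M (R ((1 / z) *\<^sub>C x)) = x" for x
    proof -
      have "z *\<^sub>C ((1 / z) *\<^sub>C R ((1 / z) *\<^sub>C x) - M (R ((1 / z) *\<^sub>C x))) = z *\<^sub>C (1 / z) *\<^sub>C x"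
        by (simp only: R(3))
      then show ?thesis
        using False by (simp add: scaleC.scale_right_diff_distrib scaleC_scaleC)
    qed
    moreover have "bounded_clinear (\<lambda>x. R ((1 / z) *\<^sub>C x))"
      using bounded_clinear_comp[OF R(1) bounded_clinear_scaleC_left] by (simp add: o_def)
    ultimately show ?thesis by blast
  qed
  then obtain f where f: "\<And>z. cmod z \<le> 1 / q \<Longrightarrow> bounded_clinear (f z)"
      "\<And>z x. cmod z \<le> 1 / q \<Longrightarrow> f z (x - z *\<^sub>C M x) = x"
      "\<And>z x. cmod z \<le> 1 / q \<Longrightarrow> f z x - z *\<^sub>C M (f z x) = x"
    by metis
  obtain C where C: "\<And>n x. (1 / q) ^ n * norm ((M ^^ n) x) \<le> C * norm x"
    using power_bounded_on_disc[OF M f, of "1 / q"] q0 by auto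
  have "norm ((M ^^ n) x) \<le> C * q ^ n * norm x" for n x
    using C[of n x] q0 by (simp add: power_divide field_simps)
  then show ?thesis by blast
qed

text \<open>For |z| > q the Neumann series of z^-(n+1) M^n converges and inverts z - M, so z is not
  in the spectrum.\<close>

theorem power_bound_imp_spectral_radius_le:
  fixes M :: "'a::complex_banach \<Rightarrow> 'a"
  assumes M: "bounded_clinear M" and C: "\<And>n x. norm ((M ^^ n) x) \<le> C * q ^ n * norm x"
    and q: "0 \<le> q"
  shows "op_spectral_radius M \<le> ennreal q"
  unfolding op_spectral_radius_def
proof (rule SUP_least, rule ccontr)
  fix z assume z: "z \<in> op_spectrum M" and "\<not> ennreal (cmod z) \<le> ennreal q"
  then have zq: "q < cmod z"
    using q by (simp add: ennreal_le_iff2 not_le)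
  then have z0: "z \<noteq> 0" using q by auto
  define p where "p = q / cmod z"
  have p: "0 \<le> p" "p < 1" using q zq by (auto simp: p_def divide_simps)
  define a where "a x n = (1 / z) ^ Suc n *\<^sub>C (M ^^ n) x" for x n
  have a_le: "norm (a x n) \<le> (C / cmod z * norm x) * p ^ n" for x n
  proof -
    have "norm (a x n) = norm ((M ^^ n) x) / cmod z ^ Suc n"
      by (simp add: a_def norm_scaleC norm_divide norm_power power_divide norm_mult)
    also have "\<dots> \<le> (C * q ^ n * norm x) / cmod z ^ Suc n"
      by (intro divide_right_mono C) auto
    also have "\<dots> = (C / cmod z * norm x) * p ^ n"
      by (simp add: p_def power_divide)
    finally show ?thesis .
  qed
  have geo: "(\<lambda>n. (C / cmod z * norm x) * p ^ n) sums ((C / cmod z * norm x) * (1 / (1 - p)))" for x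
    using p by (intro sums_mult geometric_sums) auto
  have summ: "summable (a x)" for x
    by (rule summable_comparison_test[OF _ sums_summable[OF geo[of x]]]) (use a_le in auto)
  define R where "R x = suminf (a x)" for x
  have R_sums: "a x sums R x" for x
    unfolding R_def by (rule summable_sums[OF summ])
  have aM: "a (M x) = (\<lambda>n. M (a x n))" for x
    using M by (simp add: a_def bounded_clinear_scaleC funpow_swap1 fun_eq_iff)
  have R_add: "R (x + y) = R x + R y" for x y
  proof (rule sums_unique2[OF R_sums])
    have "a (x + y) = (\<lambda>n. a x n + a y n)"
      using linear_add[OF bounded_clinear_linear[OF bounded_clinear_funpow[OF M]]]
      by (simp add: a_def scaleC_add_right fun_eq_iff)
    then show "a (x + y) sums (R x + R y)"
      using sums_add[OF R_sums R_sums] by simp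
  qed
  have R_scale: "R (b *\<^sub>C x) = b *\<^sub>C R x" for b x
  proof (rule sums_unique2[OF R_sums])
    have "bounded_linear (\<lambda>x::'a. b *\<^sub>C x)"
      using bounded_clinear_scaleC_left by (simp add: bounded_clinear_def)
    from bounded_linear.sums[OF this R_sums[of x]]
    have "(\<lambda>n. b *\<^sub>C a x n) sums (b *\<^sub>C R x)" .
    moreover have "a (b *\<^sub>C x) = (\<lambda>n. b *\<^sub>C a x n)"
      by (simp add: a_def bounded_clinear_scaleC[OF bounded_clinear_funpow[OF M]]
          scaleC_scaleC mult.commute fun_eq_iff)
    ultimately show "a (b *\<^sub>C x) sums (b *\<^sub>C R x)" by simp
  qed
  have "norm (R x) \<le> norm x * (C / cmod z * (1 / (1 - p)))" for x
    using norm_suminf_le[OF a_le sums_summable[OF geo[of x]]] sums_unique[OF geo[of x]]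
    by (simp add: R_def mult_ac)
  then have R_bl: "bounded_clinear R"
    unfolding bounded_clinear_def
    using R_add R_scale R_scale[of "of_real _"]
    by (auto intro!: bounded_linear_intro[where K = "C / cmod z * (1 / (1 - p))"]
        simp: scaleC_of_real)
  have MR: "M (R x) = R (M x)" for x
  proof (rule sums_unique2[OF _ R_sums])
    show "a (M x) sums M (R x)"
      using M bounded_linear.sums[of M, OF _ R_sums[of x]]
      by (simp add: aM bounded_clinear_def)
  qed
  \<comment> \<open>Shifting the index shows that R (M x) is z times the series for R x without its
    first term x/z.\<close>
  have right: "z *\<^sub>C R x - M (R x) = x" for x
  proof -
    have "(\<lambda>n. a (M x) n) sums R (M x)" by (rule R_sums)
    moreover have "a (M x) n = z *\<^sub>C a x (Suc n)" for n
      using z0 by (simp add: a_def scaleC_scaleC funpow_swap1)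
    ultimately have "(\<lambda>n. z *\<^sub>C a x (Suc n)) sums R (M x)" by simp
    moreover have "(\<lambda>n. z *\<^sub>C a x (Suc n)) sums (z *\<^sub>C (R x - a x 0))"
    proof -
      have "(\<lambda>n. a x (Suc n)) sums (R x - a x 0)"
        by (simp add: sums_Suc_iff R_sums)
      moreover have "bounded_linear (\<lambda>x::'a. z *\<^sub>C x)"
        using bounded_clinear_scaleC_left by (simp add: bounded_clinear_def)
      ultimately show ?thesis
        by (rule bounded_linear.sums[rotated])
    qed
    ultimately have "R (M x) = z *\<^sub>C (R x - a x 0)"
      by (rule sums_unique2)
    then show ?thesis
      using z0 by (simp add: MR a_def scaleC.scale_right_diff_distrib scaleC_scaleC)
  qed
  have "R (z *\<^sub>C x - M x) = x" for x
    using right[of x] linear_diff[OF bounded_clinear_linear[OF R_bl]]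
    by (simp add: R_scale MR)
  with right R_bl z show False
    unfolding op_spectrum_def by blast
qed

text \<open>The operator norm gives a power bound with constant 1. The corollary also supplies
  finiteness of the spectral radius for computations in \<open>ennreal\<close>.\<close>

corollary spectral_radius_le_onorm:
  fixes M :: "'a::complex_banach \<Rightarrow> 'a"
  assumes "bounded_clinear M"
  shows "op_spectral_radius M \<le> ennreal (onorm M)"
  using bounded_clinear_norm_funpow_le[OF assms] assms
  by (intro power_bound_imp_spectral_radius_le[where C = 1])
    (auto simp: bounded_clinear_def onorm_pos_le)

section \<open>Exponential decay of orbits\<close>

text \<open>Constant and rate may depend on x. The closed sets \<open>E N\<close> of points sharing
  the constant N and rate \<open>q N\<close> cover the space, so by Baire one of them contains a
  ball, and linearity carries its bound to all x.\<close>

lemma pointwise_exponential_decay_imp_uniform: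
  fixes M :: "'a::complex_banach \<Rightarrow> 'a"
  assumes M: "bounded_clinear M"
    and decay: "\<And>x. \<exists>C q. 0 < q \<and> q < 1 \<and> (\<forall>n. norm ((M ^^ n) x) \<le> C * q ^ n)"
  shows "\<exists>C q. 0 < q \<and> q < 1 \<and> (\<forall>n x. norm ((M ^^ n) x) \<le> C * q ^ n * norm x)"
proof -
  \<comment> \<open>The rates tend to 1, so a large N dominates any given constant and rate at once.
    The shift by 2 keeps \<open>q 0\<close> positive.\<close>
  define q where "q N = 1 - 1 / (real N + 2)" for N
  have q: "0 < q N" "q N < 1" for N
    by (auto simp: q_def)
  define E where "E N = (\<Inter>n. {x. norm ((M ^^ n) x) \<le> real N * q N ^ n})" for N
  have closed: "closed (E N)" for N
    unfolding E_def using bounded_clinear_funpow[OF M]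
    by (intro closed_INT ballI closed_Collect_le continuous_intros)
      (auto simp: bounded_clinear_def linear_continuous_on)
  have cover: "\<exists>N. x \<in> E N" for x
  proof -
    obtain C p where p: "0 < p" "p < 1" "\<And>n. norm ((M ^^ n) x) \<le> C * p ^ n"
      using decay by blast
    obtain N1 where N1: "C < real N1" using reals_Archimedean2 by blast
    obtain N2 where N2: "1 / (1 - p) < real N2" using reals_Archimedean2 by blast
    define N where "N = max N1 N2"
    have "1 / (1 - p) \<le> real N + 2" using N2 by (simp add: N_def)
    then have "1 / (real N + 2) \<le> 1 - p"
      using p by (simp add: field_simps)
    then have pq: "p \<le> q N" by (simp add: q_def)
    have "norm ((M ^^ n) x) \<le> real N * q N ^ n" for n
    proof -
      have "C * p ^ n \<le> real N * q N ^ n"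
        using p pq N1 by (intro mult_mono power_mono) (auto simp: N_def)
      with p(3)[of n] show ?thesis by simp
    qed
    then show ?thesis by (auto simp: E_def)
  qed
  have "\<exists>N. interior (E N) \<noteq> {}"
  proof (rule ccontr)
    assume "\<not> ?thesis"
    then have "euclidean interior_of \<Union>(range E) = {}"
      using closed
      by (intro Baire_category_alt) (auto simp: completely_metrizable_space_euclidean)
    moreover have "\<Union>(range E) = UNIV"
      using cover by blast
    ultimately show False by simp
  qed
  then obtain N x0 where "x0 \<in> interior (E N)" by blast
  then obtain r where r: "0 < r" "cball x0 r \<subseteq> E N"
    by (auto simp: mem_interior_cball)
  have lin: "linear (M ^^ n)" for n
    by (rule bounded_clinear_linear[OF bounded_clinear_funpow[OF M]])
  have "norm ((M ^^ n) x) \<le> (2 * real N / r) * q N ^ n * norm x" for n x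
  proof (cases "x = 0")
    case True
    then show ?thesis by (simp add: linear_0[OF lin])
  next
    case False
    \<comment> \<open>Rescaling x to length r keeps \<open>x0 + c *\<^sub>R x\<close> in the ball;
      the orbit of the rescaled x is a difference of two controlled orbits, whence the factor
      2.\<close>
    define c where "c = r / norm x"
    have "0 < c" using r False by (simp add: c_def)
    have "x0 + c *\<^sub>R x \<in> E N" "x0 \<in> E N"
      using r False by (auto simp: subset_iff dist_norm c_def)
    then have "norm ((M ^^ n) (x0 + c *\<^sub>R x)) \<le> real N * q N ^ n"
        "norm ((M ^^ n) x0) \<le> real N * q N ^ n"
      by (auto simp: E_def)
    moreover have "c *\<^sub>R (M ^^ n) x = (M ^^ n) (x0 + c *\<^sub>R x) - (M ^^ n) x0"
      by (simp add: linear_add[OF lin] linear_scale[OF lin])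
    ultimately have "norm (c *\<^sub>R (M ^^ n) x) \<le> 2 * (real N * q N ^ n)"
      using norm_triangle_ineq4[of "(M ^^ n) (x0 + c *\<^sub>R x)" "(M ^^ n) x0"] by simp
    then have "r * norm ((M ^^ n) x) \<le> 2 * (real N * q N ^ n) * norm x"
      using r False by (simp add: c_def field_simps)
    then show ?thesis using r by (simp add: field_simps)
  qed
  with q show ?thesis by blast
qed

text \<open>A solution sequence is the orbit of its initial value, so stability is pointwise decay,
  which the Baire argument makes uniform.\<close>

lemma exponentially_stable_iff:
  fixes M :: "'a::complex_banach \<Rightarrow> 'a"
  assumes M: "bounded_clinear M"
  shows "(\<forall>\<delta>. (\<forall>k. \<delta> (Suc k) = M (\<delta> k)) \<longrightarrow>
            (\<exists>C q. 0 < q \<and> q < 1 \<and> (\<forall>k. norm (\<delta> k) \<le> C * q ^ k))) \<longleftrightarrow>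
         (\<exists>C q. 0 < q \<and> q < 1 \<and> (\<forall>n x. norm ((M ^^ n) x) \<le> C * q ^ n * norm x))"
    (is "?L \<longleftrightarrow> ?R")
proof
  assume L: ?L
  show ?R
  proof (rule pointwise_exponential_decay_imp_uniform[OF M])
    show "\<exists>C q. 0 < q \<and> q < 1 \<and> (\<forall>n. norm ((M ^^ n) x) \<le> C * q ^ n)" for x
      using L[rule_format, of "\<lambda>n. (M ^^ n) x"] by simp
  qed
next
  assume ?R
  then obtain C q where q: "0 < q" "q < 1" "\<And>n x. norm ((M ^^ n) x) \<le> C * q ^ n * norm x"
    by blast
  show ?L
  proof (intro allI impI)
    fix \<delta> assume "\<forall>k. \<delta> (Suc k) = M (\<delta> k)"
    then have "\<delta> k = (M ^^ k) (\<delta> 0)" for k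
      by (induction k) auto
    then have "norm (\<delta> k) \<le> (C * norm (\<delta> 0)) * q ^ k" for k
      using q(3)[of k "\<delta> 0"] by (metis mult.assoc mult.commute)
    with q show "\<exists>C q. 0 < q \<and> q < 1 \<and> (\<forall>k. norm (\<delta> k) \<le> C * q ^ k)" by blast
  qed
qed

text \<open>A decay rate q < 1 bounds the spectral radius; conversely any q strictly between the
  radius and 1 is a decay rate.\<close>

theorem power_decay_iff_spectral_radius_less_1:
  fixes M :: "'a::complex_banach \<Rightarrow> 'a"
  assumes M: "bounded_clinear M"
  shows "(\<exists>C q. 0 < q \<and> q < 1 \<and> (\<forall>n x. norm ((M ^^ n) x) \<le> C * q ^ n * norm x)) \<longleftrightarrow>
         op_spectral_radius M < 1"
proof
  assume "\<exists>C q. 0 < q \<and> q < 1 \<and> (\<forall>n x. norm ((M ^^ n) x) \<le> C * q ^ n * norm x)"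
  then obtain C q where q: "0 < q" "q < 1" "\<And>n x. norm ((M ^^ n) x) \<le> C * q ^ n * norm x"
    by blast
  have "op_spectral_radius M \<le> ennreal q"
    by (rule power_bound_imp_spectral_radius_le[OF M q(3)]) (use q in simp)
  also have "\<dots> < 1"
    using q by (simp add: ennreal_less_one_iff)
  finally show "op_spectral_radius M < 1" .
next
  assume "op_spectral_radius M < 1"
  then obtain e where e: "op_spectral_radius M < e" "e < 1"
    using dense by blast
  obtain q where q: "0 \<le> q" "e = ennreal q"
    using e by (cases e) auto
  have q1: "0 < q" "q < 1"
    using e q by (cases "q = 0"; simp add: ennreal_less_one_iff)+
  show "\<exists>C q. 0 < q \<and> q < 1 \<and> (\<forall>n x. norm ((M ^^ n) x) \<le> C * q ^ n * norm x)"
    using spectral_radius_less_imp_power_bound[OF M, of q] e q q1 by blast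
qed

text \<open>Commutation gives (A B)^n = A^n B^n, so decay rates multiply.\<close>

theorem spectral_radius_comp_less_1:
  fixes A B :: "'a::complex_banach \<Rightarrow> 'a"
  assumes A: "bounded_clinear A" and B: "bounded_clinear B" and comm: "A \<circ> B = B \<circ> A"
    and less: "op_spectral_radius A * op_spectral_radius B < 1"
  shows "op_spectral_radius (A \<circ> B) < 1"
proof -
  have fin: "op_spectral_radius A < top" "op_spectral_radius B < top"
    using spectral_radius_le_onorm[OF A] spectral_radius_le_onorm[OF B]
    by (auto intro: le_less_trans)
  obtain a where a: "0 \<le> a" "op_spectral_radius A = ennreal a"
    using fin by (cases "op_spectral_radius A") auto
  obtain b where b: "0 \<le> b" "op_spectral_radius B = ennreal b"
    using fin by (cases "op_spectral_radius B") auto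
  have ab: "a * b < 1"
    using less a b by (simp add: ennreal_mult[symmetric] ennreal_less_one_iff)
  \<comment> \<open>Power bounds are available at rates strictly above the radii; continuity at h =
    0 gives room to enlarge both rates and keep the product below 1.\<close>
  have "((\<lambda>h. (a + h) * (b + h)) \<longlongrightarrow> (a + 0) * (b + 0)) (at_right 0)"
    by (intro tendsto_intros)
  then have "\<forall>\<^sub>F h in at_right 0. (a + h) * (b + h) < 1"
    using ab by (intro order_tendstoD) auto
  moreover have "\<forall>\<^sub>F h in at_right (0::real). 0 < h"
    by (rule eventually_at_right_less)
  ultimately have "\<forall>\<^sub>F h in at_right 0. (a + h) * (b + h) < 1 \<and> 0 < h"
    by (rule eventually_conj)
  then obtain h where h: "(a + h) * (b + h) < 1" "0 < h"
    using eventually_happens trivial_limit_at_right_real by blast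
  obtain C where C: "\<And>n x. norm ((A ^^ n) x) \<le> C * (a + h) ^ n * norm x"
    using spectral_radius_less_imp_power_bound[OF A, of "a + h"] a h
    by (auto simp: ennreal_less_iff)
  obtain D where D: "\<And>n x. norm ((B ^^ n) x) \<le> D * (b + h) ^ n * norm x"
    using spectral_radius_less_imp_power_bound[OF B, of "b + h"] b h
    by (auto simp: ennreal_less_iff)
  have swap: "A (B x) = B (A x)" for x
    using comm by (metis comp_apply)
  have An: "(A ^^ n) (B x) = B ((A ^^ n) x)" for n x
    by (induction n) (simp_all add: swap)
  have pow: "((A \<circ> B) ^^ n) x = (A ^^ n) ((B ^^ n) x)" for n x
    by (induction n) (simp_all add: An)
  have "norm (((A \<circ> B) ^^ n) x) \<le> (\<bar>C\<bar> * D) * ((a + h) * (b + h)) ^ n * norm x" for n x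
  proof -
    have "norm ((A ^^ n) ((B ^^ n) x)) \<le> C * (a + h) ^ n * norm ((B ^^ n) x)"
      by (rule C)
    \<comment> \<open>The sign of C is unknown, so its absolute value is used to keep the product
      monotone.\<close>
    also have "\<dots> \<le> \<bar>C\<bar> * (a + h) ^ n * (D * (b + h) ^ n * norm x)"
      using a h by (intro mult_mono D) auto
    finally show ?thesis
      by (simp add: pow power_mult_distrib mult_ac)
  qed
  moreover have "0 < (a + h) * (b + h)"
    using a b h by simp
  ultimately show ?thesis
    using power_decay_iff_spectral_radius_less_1[OF bounded_clinear_comp[OF A B]] h(1) by blast
qed

section \<open>Spectral derivatives and feedback loops\<close>

text \<open>By \<open>spec_deriv_eqI\<close> any expansion may replace the chosen one. Its first
  coefficient depends only on entry 0 of the sequence, so its multilinearity there is ordinary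
  linearity on constant sequences.\<close>

lemma bounded_clinear_spec_deriv:
  assumes "spectrally_analytic F"
  shows "bounded_clinear (spec_deriv F A)"
proof -
  obtain c where c: "has_spec_taylor F A c"
    using assms by (auto simp: spectrally_analytic_def)
  then have m: "bounded_cmultilinear 1 (c 1)"
    by (simp add: has_spec_taylor_def)
  note m = m[unfolded bounded_cmultilinear_def]
  have local: "c 1 v = c 1 w" if "v 0 = w 0" for v w
    by (rule m[THEN conjunct1, rule_format]) (simp add: that)
  have add: "c 1 (v(0 := x + y)) = c 1 (v(0 := x)) + c 1 (v(0 := y))" for v x y
    by (rule m[THEN conjunct2, THEN conjunct1, rule_format]) simp
  have scale: "c 1 (v(0 := a *\<^sub>C x)) = a *\<^sub>C c 1 (v(0 := x))" for v a x
    by (rule m[THEN conjunct2, THEN conjunct2, THEN conjunct1, rule_format]) simp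
  have "\<exists>C. \<forall>v. norm (c 1 v) \<le> C * norm (v 0)"
    using m[THEN conjunct2, THEN conjunct2, THEN conjunct2] by simp
  then obtain C where C: "\<And>v. norm (c 1 v) \<le> C * norm (v 0)" by blast
  have upd: "c 1 ((\<lambda>_. 0)(0 := x)) = c 1 (\<lambda>_. x)" for x
    by (rule local) simp
  have D: "spec_deriv F A x = c 1 (\<lambda>_. x)" for x
    by (rule spec_deriv_eqI[OF c])
  have scale': "spec_deriv F A (a *\<^sub>C x) = a *\<^sub>C spec_deriv F A x" for a x
    using scale[of "\<lambda>_. 0" a x] by (simp only: upd D)
  have "bounded_linear (spec_deriv F A)"
  proof (rule bounded_linear_intro)
    show "spec_deriv F A (x + y) = spec_deriv F A x + spec_deriv F A y" for x y
      using add[of "\<lambda>_. 0" x y] by (simp only: upd D)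
    show "spec_deriv F A (r *\<^sub>R x) = r *\<^sub>R spec_deriv F A x" for r x
      using scale'[of "of_real r" x] by (simp add: scaleC_of_real)
    show "norm (spec_deriv F A x) \<le> norm x * C" for x
      using C[of "\<lambda>_. x"] by (simp add: D mult.commute)
  qed
  with scale' show ?thesis by (simp add: bounded_clinear_def)
qed

lemma bounded_clinear_feedback_op:
  "feedback_loop T F A \<Longrightarrow> bounded_clinear (feedback_op T F A)"
  by (simp add: feedback_loop_def feedback_op_def bounded_clinear_comp bounded_clinear_spec_deriv)

lemma lin_spec_stable_iff:
  "feedback_loop T F A \<Longrightarrow> lin_spec_stable T F A \<longleftrightarrow> op_spectral_radius (feedback_op T F A) < 1"
  by (simp add: lin_spec_stable_def exponentially_stable_iff
      power_decay_iff_spectral_radius_less_1 bounded_clinear_feedback_op)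

text \<open>A linear map is its own first-order expansion at every point, with no higher
  terms.\<close>

lemma has_spec_taylor_bounded_clinear:
  assumes F: "bounded_clinear F"
  shows "has_spec_taylor F A (\<lambda>k v. if k = 1 then F (v 0) else 0)"
  unfolding has_spec_taylor_def
proof (intro conjI allI impI exI[of _ 1])
  fix k :: nat assume "1 \<le> k"
  show "bounded_cmultilinear k (\<lambda>v. if k = 1 then F (v 0) else 0)"
  proof (cases "k = 1")
    case True
    have "\<exists>C. \<forall>v. norm (F (v 0)) \<le> C * norm (v 0 :: 'a)"
      using bounded_clinear_norm_le[OF F] by blast
    moreover have "F (x + y) = F x + F y" "F (a *\<^sub>C x) = a *\<^sub>C F x" for a x y
      using F by (simp_all add: linear_add[OF bounded_clinear_linear] bounded_clinear_scaleC)
    ultimately show ?thesis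
      unfolding bounded_cmultilinear_def True by simp
  next
    case False
    then show ?thesis
      by (auto simp: bounded_cmultilinear_def intro!: exI[of _ 0])
  qed
next
  fix h :: 'a
  \<comment> \<open>The summation index is one less than the order, so only index 0
    contributes.\<close>
  have "(\<lambda>k. (1 / fact (Suc k)) *\<^sub>R (if Suc k = 1 then F h else 0)) sums
      (\<Sum>k\<in>{0}. (1 / fact (Suc k)) *\<^sub>R (if Suc k = 1 then F h else 0))"
    by (intro sums_finite) auto
  then show "(\<lambda>k. (1 / fact (Suc k)) *\<^sub>R (if Suc k = 1 then F h else 0)) sums (F (A + h) - F A)"
    using F by (simp add: linear_add[OF bounded_clinear_linear])
qed simp

lemma spec_deriv_bounded_clinear: "bounded_clinear F \<Longrightarrow> spec_deriv F A = F"
  using spec_deriv_eqI[OF has_spec_taylor_bounded_clinear, of F A] by auto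

text \<open>A linear F fixes 0 and is its own derivative, so every pair of bounded operators arises
  from a loop and examples reduce to pairs of matrices.\<close>

lemma feedback_loop_bounded_clinear:
  assumes "bounded_clinear T" "bounded_clinear F"
  shows "feedback_loop T F 0"
  using assms has_spec_taylor_bounded_clinear[OF assms(2)]
  by (auto simp: feedback_loop_def spectrally_analytic_def linear_0[OF bounded_clinear_linear])

section \<open>Spectral radii of examples, extended reals and matrix units\<close>

text \<open>Powers from the second on vanish, so every q > 0 is an admissible rate; the constant 1 +
  |M|/q takes care of exponents 0 and 1.\<close>

lemma spectral_radius_square_zero:
  assumes M: "bounded_clinear M" and nil: "\<And>x. M (M x) = 0"
  shows "op_spectral_radius M = 0"
proof (rule ccontr)
  assume "op_spectral_radius M \<noteq> 0"
  then have "0 < op_spectral_radius M"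
    by (simp add: zero_less_iff_neq_zero)
  then obtain e where e: "0 < e" "e < op_spectral_radius M"
    using dense by blast
  obtain q where q: "0 < q" "e = ennreal q"
    using e by (cases e) (auto simp: ennreal_zero_less_top)
  have m: "0 \<le> onorm M"
    using M by (simp add: bounded_clinear_def onorm_pos_le)
  have "norm ((M ^^ n) x) \<le> (1 + onorm M / q) * q ^ n * norm x" for n x
  proof -
    consider "n = 0" | "n = 1" | k where "n = Suc (Suc k)"
      by (metis One_nat_def not0_implies_Suc)
    then show ?thesis
    proof cases
      case 1
      then show ?thesis using m q by (simp add: algebra_simps)
    next
      case 2
      have "norm (M x) \<le> onorm M * norm x"
        by (rule bounded_clinear_norm_le[OF M])
      also have "\<dots> \<le> (1 + onorm M / q) * q * norm x"
        using q by (intro mult_right_mono) (auto simp: field_simps)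
      finally show ?thesis using 2 by simp
    next
      case 3
      then show ?thesis using m q by (simp add: nil)
    qed
  qed
  then have "op_spectral_radius M \<le> ennreal q"
    using q by (intro power_bound_imp_spectral_radius_le[OF M]) auto
  with e q show False by simp
qed

text \<open>An inverse of z - M would have to send 0 back to x.\<close>

lemma eigenvalue_le_spectral_radius:
  assumes "M x = z *\<^sub>C x" "x \<noteq> 0"
  shows "ennreal (cmod z) \<le> op_spectral_radius M"
proof -
  have "z \<in> op_spectrum M"
  proof (rule ccontr)
    assume "z \<notin> op_spectrum M"
    then obtain R where R: "bounded_clinear R" "R (z *\<^sub>C x - M x) = x"
      unfolding op_spectrum_def by blast
    with assms show False by (simp add: linear_0[OF bounded_clinear_linear])
  qed
  then show ?thesis
    unfolding op_spectral_radius_def by (rule SUP_upper)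
qed

text \<open>This matches the product condition with the stability radius. For b = 0 the quotient is
  infinite and both sides hold; otherwise the claim is one about real numbers.\<close>

lemma ennreal_mult_less_1_iff:
  fixes a b :: ennreal
  assumes "a < top" "b < top"
  shows "a * b < 1 \<longleftrightarrow> a < 1 / b"
proof (cases "b = 0")
  case True
  then show ?thesis using assms by simp
next
  case False
  obtain x y where x: "0 \<le> x" "a = ennreal x" and y: "0 \<le> y" "b = ennreal y"
    using assms by (cases a; cases b) auto
  have "0 < y" using False y by (cases "y = 0") auto
  then have "1 / b = ennreal (1 / y)"
    using divide_ennreal[of 1 y] y by simp
  then show ?thesis
    using x y \<open>0 < y\<close> by (simp add: ennreal_mult[symmetric] ennreal_less_one_iff ennreal_less_iff field_simps)
qed

text \<open>This is the matrix unit with its 1 in row i and column j.\<close>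

lemma bounded_clinear_matrix_unit:
  "bounded_clinear (\<lambda>v::complex ^ 'n. axis i (v $ j) :: complex ^ 'm)"
  unfolding bounded_clinear_def
proof (intro conjI allI)
  show "bounded_linear (\<lambda>v::complex ^ 'n. axis i (v $ j) :: complex ^ 'm)"
  proof (rule bounded_linear_intro[where K = 1])
    show "norm (axis i (v $ j) :: complex ^ 'm) \<le> norm v * 1" for v :: "complex ^ 'n"
    proof -
      have "norm (axis i (v $ j) :: complex ^ 'm) = norm (v $ j)"
        by (simp only: norm_eq_sqrt_inner inner_axis_axis refl if_True)
      then show ?thesis
        using Finite_Cartesian_Product.norm_nth_le[of v j] by simp
    qed
  qed (simp_all add: vec_eq_iff axis_def)
qed (simp add: vec_eq_iff axis_def scaleC_vec_def scaleC_complex_def)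

section \<open>The stability criterion, sufficient conditions and counterexamples\<close>

theorem theorem5:
  shows
    "(\<forall>(T :: 'a::complex_banach \<Rightarrow> 'a) F A. feedback_loop T F A \<longrightarrow>
        (lin_spec_stable T F A \<longleftrightarrow> op_spectral_radius (feedback_op T F A) < 1))
     \<and>
     (\<forall>(T :: 'h::complex_hilbert \<Rightarrow> 'h) F A. feedback_loop T F A \<longrightarrow>
        normal_op T \<longrightarrow> normal_op (spec_deriv F A) \<longrightarrow>
        spec_deriv F A \<circ> T = T \<circ> spec_deriv F A \<longrightarrow>
        (op_spectral_radius T * op_spectral_radius (spec_deriv F A) < 1 \<longrightarrow>
           lin_spec_stable T F A) \<and>
        (op_spectral_radius T * op_spectral_radius (spec_deriv F A) < 1 \<longleftrightarrow>
           op_spectral_radius T < soc_radius F A))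
     \<and>
     (\<exists>A B :: complex ^ 2 \<Rightarrow> complex ^ 2. bounded_clinear A \<and> bounded_clinear B \<and>
        A \<circ> B \<noteq> B \<circ> A \<and>
        \<not> op_spectral_radius (A \<circ> B) \<le> op_spectral_radius A * op_spectral_radius B)
     \<and>
     (\<exists>(T :: complex ^ 2 \<Rightarrow> complex ^ 2) F A. feedback_loop T F A \<and>
        spec_deriv F A \<circ> T \<noteq> T \<circ> spec_deriv F A \<and>
        op_spectral_radius T * op_spectral_radius (spec_deriv F A) < 1 \<and>
        \<not> lin_spec_stable T F A)
     \<and>
     (\<forall>(T :: 'a \<Rightarrow> 'a) F A. feedback_loop T F A \<longrightarrow>
        onorm (feedback_op T F A) < 1 \<longrightarrow> lin_spec_stable T F A)
     \<and>
     (\<exists>(T :: complex ^ 2 \<Rightarrow> complex ^ 2) F A. feedback_loop T F A \<and>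
        spec_deriv F A \<circ> T \<noteq> T \<circ> spec_deriv F A \<and>
        lin_spec_stable T F A \<and> \<not> onorm (feedback_op T F A) < 1)"
proof -
  \<comment> \<open>Matrix units. \<open>E 1 2\<close> and \<open>E 2 1\<close> have square zero,
    hence radius 0, yet their product \<open>E 1 1\<close> has eigenvalue 1.\<close>
  define E :: "2 \<Rightarrow> 2 \<Rightarrow> complex ^ 2 \<Rightarrow> complex ^ 2" where "E i j v = axis i (v $ j)" for i j v
  have E: "bounded_clinear (E i j)" for i j
    unfolding E_def by (rule bounded_clinear_matrix_unit)
  have EE: "E i j (E k l v) = (if j = k then E i l v else 0)" for i j k l v
    by (auto simp: E_def vec_eq_iff axis_def)
  have E_axis: "E i j (axis j 1) = axis i 1" for i j
    by (simp add: E_def axis_def)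
  have axis_ne: "axis i (1::complex) \<noteq> 0" for i :: 2
    by (simp add: axis_eq_0_iff)
  have rho0: "op_spectral_radius (E 1 2) = 0" "op_spectral_radius (E 2 1) = 0"
    by (auto intro!: spectral_radius_square_zero E simp: EE)
  have comp: "E i j \<circ> E j l = E i l" for i j l
    by (simp add: fun_eq_iff EE)
  have "ennreal (cmod 1) \<le> op_spectral_radius (E i i)" for i
    by (rule eigenvalue_le_spectral_radius[of _ "axis i 1"]) (simp_all add: E_axis axis_ne)
  then have rho1: "1 \<le> op_spectral_radius (E i i)" for i
    by simp
  have nc1: "E 1 2 \<circ> E 2 1 \<noteq> E 2 1 \<circ> E 1 2"
  proof
    assume "E 1 2 \<circ> E 2 1 = E 2 1 \<circ> E 1 2"
    then have "E 1 1 (axis 1 1) = E 2 2 (axis 1 1)"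
      by (simp add: comp)
    then show False by (simp add: E_def vec_eq_iff axis_def forall_2)
  qed
  have nc2: "E 1 1 \<circ> E 1 2 \<noteq> E 1 2 \<circ> E 1 1"
  proof
    assume "E 1 1 \<circ> E 1 2 = E 1 2 \<circ> E 1 1"
    then have "E 1 2 (axis 2 1) = (E 1 2 \<circ> E 1 1) (axis 2 1)"
      by (simp add: comp)
    then show False by (simp add: EE E_axis axis_ne)
  qed
  show ?thesis
  proof (intro conjI allI impI)
    fix T F and A :: 'a assume "feedback_loop T F A"
    then show "lin_spec_stable T F A \<longleftrightarrow> op_spectral_radius (feedback_op T F A) < 1"
      by (rule lin_spec_stable_iff)
  next
    fix T F and A :: 'h
    assume loop: "feedback_loop T F A" and comm: "spec_deriv F A \<circ> T = T \<circ> spec_deriv F A"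
    have T: "bounded_clinear T" and D: "bounded_clinear (spec_deriv F A)"
      using loop by (auto simp: feedback_loop_def bounded_clinear_spec_deriv)
    show "lin_spec_stable T F A" if "op_spectral_radius T * op_spectral_radius (spec_deriv F A) < 1"
      using spectral_radius_comp_less_1[OF D T comm] that
      by (simp add: lin_spec_stable_iff[OF loop] feedback_op_def mult.commute)
    show "op_spectral_radius T * op_spectral_radius (spec_deriv F A) < 1 \<longleftrightarrow>
        op_spectral_radius T < soc_radius F A"
      unfolding soc_radius_def
      using spectral_radius_le_onorm[OF T] spectral_radius_le_onorm[OF D]
      by (intro ennreal_mult_less_1_iff) (auto intro: le_less_trans)
  next
    show "\<exists>A B :: complex ^ 2 \<Rightarrow> complex ^ 2. bounded_clinear A \<and> bounded_clinear B \<and>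
        A \<circ> B \<noteq> B \<circ> A \<and>
        \<not> op_spectral_radius (A \<circ> B) \<le> op_spectral_radius A * op_spectral_radius B"
      using rho1[of 1] E nc1
      by (intro exI[of _ "E 1 2"] exI[of _ "E 2 1"]) (auto simp: comp rho0)
  next
    \<comment> \<open>The same pair read as a loop: the product of the radii is 0, but the feedback
      operator is \<open>E 1 1\<close>, of radius at least 1.\<close>
    have loop: "feedback_loop (E 2 1) (E 1 2) 0"
      by (rule feedback_loop_bounded_clinear[OF E E])
    show "\<exists>(T :: complex ^ 2 \<Rightarrow> complex ^ 2) F A. feedback_loop T F A \<and>
        spec_deriv F A \<circ> T \<noteq> T \<circ> spec_deriv F A \<and>
        op_spectral_radius T * op_spectral_radius (spec_deriv F A) < 1 \<and>
        \<not> lin_spec_stable T F A"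
      using loop nc1 rho1[of 1]
      by (intro exI[of _ "E 2 1"] exI[of _ "E 1 2"] exI[of _ 0])
        (auto simp: lin_spec_stable_iff[OF loop] feedback_op_def spec_deriv_bounded_clinear[OF E]
          comp rho0)
  next
    fix T F and A :: 'a
    assume loop: "feedback_loop T F A" and less: "onorm (feedback_op T F A) < 1"
    have M: "bounded_clinear (feedback_op T F A)"
      by (rule bounded_clinear_feedback_op[OF loop])
    then have "ennreal (onorm (feedback_op T F A)) < 1"
      using less onorm_pos_le by (auto simp: bounded_clinear_def ennreal_less_one_iff)
    then show "lin_spec_stable T F A"
      using le_less_trans[OF spectral_radius_le_onorm[OF M]]
      by (simp add: lin_spec_stable_iff[OF loop])
  next
    \<comment> \<open>Here the feedback operator is \<open>E 1 1 \<circ> E 1 2 = E 1 2\<close>: it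
      has square zero, hence is stable, but it maps a unit vector to a unit vector.\<close>
    have loop: "feedback_loop (E 1 2) (E 1 1) 0"
      by (rule feedback_loop_bounded_clinear[OF E E])
    have "norm (axis 1 1 :: complex ^ 2) \<le> onorm (E 1 2) * norm (axis 2 1 :: complex ^ 2)"
      using bounded_clinear_norm_le[OF E[of 1 2], of "axis 2 1"] by (simp add: E_axis)
    then have "1 \<le> onorm (E 1 2)"
      by simp
    then show "\<exists>(T :: complex ^ 2 \<Rightarrow> complex ^ 2) F A. feedback_loop T F A \<and>
        spec_deriv F A \<circ> T \<noteq> T \<circ> spec_deriv F A \<and>
        lin_spec_stable T F A \<and> \<not> onorm (feedback_op T F A) < 1"
      using loop nc2
      by (intro exI[of _ "E 1 2"] exI[of _ "E 1 1"] exI[of _ 0])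
        (auto simp: lin_spec_stable_iff[OF loop] feedback_op_def spec_deriv_bounded_clinear[OF E]
          comp rho0)
  qed
qed

end
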